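(* If $G$ and $H$ are bypass over-visible graphs, then $\mu_{\rm t}(G\,\square\,H)>\mu_{\rm t}(G)\,\mu_{\rm t}(H)$.
   Context: All graphs are finite, simple and connected. For $X\subseteq V(G)$, two vertices $x,y$ are $X$-visible if there is a shortest $x,y$-path $P$ with $V(P)\cap X\subseteq\{x,y\}$; $X$ is a total mutual-visibility set if every pair of vertices of $G$ is $X$-visible. $\mu_{\rm t}(G)$ is the largest cardinality of a total mutual-visibility set of $G$, and a $\mu_{\rm t}$-set is a total mutual-visibility set of that cardinality. A subgraph $H$ of $G$ is convex if for all $x,y\in V(H)$ every shortest $x,y$-path of $G$ lies in $H$. A vertex is a bypass vertex if it is not the middle vertex of a convex $P_3$ in $G$. A graph $G$ is bypass over-visible if it contains an independent set $U$ consisting of bypass vertices such that $U$ contains some $\mu_{\rm t}$-set $U'$ of $G$ as a proper subset ($U'\subsetneq U$). The Cartesian product $G\,\square\,H$ has vertex set $V(G)\times V(H)$, with $(g,h)$ adjacent to $(g',h')$ iff either $gg'\in E(G)$ and $h=h'$, or $g=g'$ and $hh'\in E(H)$. *)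

theory Defs
  imports "Graph_Theory.Graph_Theory"
begin

(* An undirected edge xy is represented by the two arcs (x, y) and (y, x); pair_graph then
   says: finite, symmetric, loop-free, and without parallel arcs. *)
definition simple_connected_graph :: "'a pair_pre_digraph \<Rightarrow> bool" where
  "simple_connected_graph G \<longleftrightarrow> pair_graph G \<and> Digraph_Component.connected (with_proj G)"

(* A path is given by its list of vertices; for x = y the only path is [x]. *)
definition path_between :: "'a pair_pre_digraph \<Rightarrow> 'a \<Rightarrow> 'a vwalk \<Rightarrow> 'a \<Rightarrow> bool" where
  "path_between G x P y \<longleftrightarrow> vpath P (with_proj G) \<and> hd P = x \<and> last P = y"

definition shortest_path :: "'a pair_pre_digraph \<Rightarrow> 'a \<Rightarrow> 'a vwalk \<Rightarrow> 'a \<Rightarrow> bool" where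
  "shortest_path G x P y \<longleftrightarrow>
     path_between G x P y \<and>
     (\<forall>Q. path_between G x Q y \<longrightarrow> vwalk_length P \<le> vwalk_length Q)"

definition visible :: "'a pair_pre_digraph \<Rightarrow> 'a set \<Rightarrow> 'a \<Rightarrow> 'a \<Rightarrow> bool" where
  "visible G X x y \<longleftrightarrow> (\<exists>P. shortest_path G x P y \<and> set P \<inter> X \<subseteq> {x, y})"

definition total_mutual_visibility_set :: "'a pair_pre_digraph \<Rightarrow> 'a set \<Rightarrow> bool" where
  "total_mutual_visibility_set G X \<longleftrightarrow>
     X \<subseteq> pverts G \<and> (\<forall>x\<in>pverts G. \<forall>y\<in>pverts G. visible G X x y)"

(* For a finite connected graph the maximum is over a finite nonempty set:
   the empty set is always a total mutual-visibility set. *)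
definition mu_t :: "'a pair_pre_digraph \<Rightarrow> nat" where
  "mu_t G = Max (card ` {X. total_mutual_visibility_set G X})"

definition mu_t_set :: "'a pair_pre_digraph \<Rightarrow> 'a set \<Rightarrow> bool" where
  "mu_t_set G X \<longleftrightarrow> total_mutual_visibility_set G X \<and> card X = mu_t G"

(* Both the vertices and the edges of each shortest path have to belong to H. *)
definition convex_subgraph :: "'a pair_pre_digraph \<Rightarrow> 'a pair_pre_digraph \<Rightarrow> bool" where
  "convex_subgraph H G \<longleftrightarrow>
     pair_graph H \<and> subgraph (with_proj H) (with_proj G) \<and>
     (\<forall>x\<in>pverts H. \<forall>y\<in>pverts H. \<forall>P. shortest_path G x P y \<longrightarrow>
        set P \<subseteq> pverts H \<and> set (vwalk_arcs P) \<subseteq> parcs H)"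

(* The path x - v - y on three vertices; a P3 only for pairwise distinct x, v, y. *)
definition path3 :: "'a \<Rightarrow> 'a \<Rightarrow> 'a \<Rightarrow> 'a pair_pre_digraph" where
  "path3 x v y =
     \<lparr> pverts = {x, v, y}, parcs = {(x, v), (v, x), (v, y), (y, v)} \<rparr>"

definition bypass_vertex :: "'a pair_pre_digraph \<Rightarrow> 'a \<Rightarrow> bool" where
  "bypass_vertex G v \<longleftrightarrow>
     v \<in> pverts G \<and> \<not> (\<exists>x y. distinct [x, v, y] \<and> convex_subgraph (path3 x v y) G)"

definition independent_set :: "'a pair_pre_digraph \<Rightarrow> 'a set \<Rightarrow> bool" where
  "independent_set G U \<longleftrightarrow> U \<subseteq> pverts G \<and> (\<forall>u\<in>U. \<forall>v\<in>U. (u, v) \<notin> parcs G)"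

definition bypass_over_visible :: "'a pair_pre_digraph \<Rightarrow> bool" where
  "bypass_over_visible G \<longleftrightarrow>
     (\<exists>U U'. independent_set G U \<and> (\<forall>u\<in>U. bypass_vertex G u) \<and>
             mu_t_set G U' \<and> U' \<subset> U)"

definition cartesian_product ::
  "'a pair_pre_digraph \<Rightarrow> 'b pair_pre_digraph \<Rightarrow> ('a \<times> 'b) pair_pre_digraph" where
  "cartesian_product G H =
     \<lparr> pverts = pverts G \<times> pverts H,
       parcs = {((g, h), (g', h')).
                  g \<in> pverts G \<and> g' \<in> pverts G \<and> h \<in> pverts H \<and> h' \<in> pverts H \<and>
                  ((g, g') \<in> parcs G \<and> h = h' \<or> g = g' \<and> (h, h') \<in> parcs H)} \<rparr>"

end

theory Submission
  imports Defs
begin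

text \<open>
  With \<open>S \<subset> U\<close> and \<open>T \<subset> V\<close> witnessing that \<open>G\<close> and \<open>H\<close> are bypass over-visible,
  \<open>g \<in> U - S\<close> and \<open>h \<in> V - T\<close>, the set \<open>S \<times> T \<union> {(g, h)}\<close> is a total mutual-visibility
  set of the product. For pairs within one layer only the trace of the set on that layer
  matters, which is contained in \<open>S\<close> or \<open>{g}\<close> (or \<open>T\<close> or \<open>{h}\<close>); a single bypass vertex can
  be replaced on any shortest path by another common neighbour of its two neighbours there.
  Pairs in different layers only need independence of \<open>U\<close> and \<open>V\<close>.
\<close>

section \<open>Walks, shortest paths and visibility\<close>

text \<open>This is \<open>path_between\<close> without distinctness of vertices. Joined walks and
  projections of product paths may repeat vertices, so lengths are compared among walks.\<close>

definition walk_between :: "'a pair_pre_digraph \<Rightarrow> 'a \<Rightarrow> 'a vwalk \<Rightarrow> 'a \<Rightarrow> bool" where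
  "walk_between G x P y \<longleftrightarrow> vwalk P (with_proj G) \<and> hd P = x \<and> last P = y"

lemma walk_between_nonempty: "walk_between G x P y \<Longrightarrow> P \<noteq> []"
  by (auto simp: walk_between_def)

lemma walk_between_verts: "walk_between G x P y \<Longrightarrow> set P \<subseteq> pverts G"
  by (auto simp: walk_between_def vwalk_def)

lemma walk_between_ends:
  assumes "walk_between G x P y"
  shows "x \<in> set P" "y \<in> set P" "x \<in> pverts G" "y \<in> pverts G"
  using assms walk_between_nonempty[OF assms] walk_between_verts[OF assms]
  by (auto simp: walk_between_def)

lemma shortest_path_walk: "shortest_path G x P y \<Longrightarrow> walk_between G x P y"
  by (auto simp: shortest_path_def path_between_def walk_between_def)

lemma walk_between_singleton: "x \<in> pverts G \<Longrightarrow> walk_between G x [x] x"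
  by (auto simp: walk_between_def vwalk_def)

lemma walk_between_join:
  assumes "walk_between G x P y" "walk_between G y Q z"
  shows "walk_between G x (P \<oplus> Q) z"
    and "vwalk_length (P \<oplus> Q) = vwalk_length P + vwalk_length Q"
    and "set (P \<oplus> Q) \<subseteq> set P \<union> set Q"
proof -
  have "joinable P Q"
    using assms walk_between_nonempty by (auto simp: walk_between_def joinable_def)
  then show "walk_between G x (P \<oplus> Q) z"
    and "vwalk_length (P \<oplus> Q) = vwalk_length P + vwalk_length Q"
    using assms vwalk_joinI_vwalk[of P "with_proj G" Q] vwalk_join_hd[of P Q]
      vwalk_join_last[of P Q] vwalk_join_vwalk_length[of P Q]
    by (auto simp: walk_between_def simp del: vwalk_length_simp)
  show "set (P \<oplus> Q) \<subseteq> set P \<union> set Q"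
    by (cases Q) (auto simp: vwalk_join_def)
qed

lemma length_vwalk_to_vpath: "length (vwalk_to_vpath p) \<le> length p"
  by (induct p rule: vwalk_to_vpath.induct)
    (auto intro: le_SucI order_trans[OF _ length_dropWhile_le])

lemma walk_between_to_path:
  assumes "walk_between G x P y"
  shows "path_between G x (vwalk_to_vpath P) y"
  using assms
  by (auto simp: walk_between_def path_between_def vwalk_to_vpath_vpath vwalk_to_vpath_hd
      vwalk_to_vpath_last)

text \<open>Cutting the cycles out of \<open>Q\<close> leaves a path with the same ends that is no
  longer than \<open>Q\<close>.\<close>

lemma shortest_path_le_walk:
  assumes "shortest_path G x P y" "walk_between G x Q y"
  shows "vwalk_length P \<le> vwalk_length Q"
proof -
  have "vwalk_length P \<le> vwalk_length (vwalk_to_vpath Q)"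
    using assms(1) walk_between_to_path[OF assms(2)]
    by (simp add: shortest_path_def del: vwalk_length_simp)
  also have "\<dots> \<le> vwalk_length Q"
    using length_vwalk_to_vpath[of Q] by (simp add: diff_le_mono)
  finally show ?thesis .
qed

text \<open>Cutting cycles keeps the ends and enlarges neither the length nor the vertex set.
  Visibility can thus be shown with a walk of minimal length, without checking that it is a
  path.\<close>

lemma visibleI:
  assumes "walk_between G x P y"
    and "\<And>Q. walk_between G x Q y \<Longrightarrow> vwalk_length P \<le> vwalk_length Q"
    and "set P \<inter> X \<subseteq> {x, y}"
  shows "visible G X x y"
  unfolding visible_def
proof (intro exI conjI)
  show "shortest_path G x (vwalk_to_vpath P) y"
    unfolding shortest_path_def
  proof (intro conjI allI impI)
    fix Q assume "path_between G x Q y"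
    then have "vwalk_length P \<le> vwalk_length Q"
      using assms(2) by (auto simp: path_between_def walk_between_def)
    then show "vwalk_length (vwalk_to_vpath P) \<le> vwalk_length Q"
      using length_vwalk_to_vpath[of P] by simp
  qed (rule walk_between_to_path[OF assms(1)])
  show "set (vwalk_to_vpath P) \<inter> X \<subseteq> {x, y}"
    using assms(3) vwalk_to_vpath_subset by fast
qed

lemma total_mutual_visibility_set_subset:
  assumes "total_mutual_visibility_set G X" "Y \<subseteq> X"
  shows "total_mutual_visibility_set G Y"
  using assms unfolding total_mutual_visibility_set_def visible_def by blast

lemma shortest_path_exists:
  assumes "simple_connected_graph G" "x \<in> pverts G" "y \<in> pverts G"
  obtains P where "shortest_path G x P y"
proof -
  interpret pair_graph G using assms(1) by (simp add: simple_connected_graph_def)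
  have "strongly_connected (with_proj G)"
    using assms(1) symmetric_connected_imp_strongly_connected pair_sym_arcs
    by (simp add: simple_connected_graph_def)
  then have "\<exists>P. path_between G x P y"
    using assms(2,3) reachable_vpath_conv[of x y]
    by (auto simp: strongly_connected_def path_between_def)
  then show ?thesis
    using that ex_has_least_nat[of "\<lambda>P. path_between G x P y" _ vwalk_length]
    unfolding shortest_path_def by blast
qed

section \<open>Bypass vertices\<close>

text \<open>The path x - v - y is not convex, so some shortest path between two of its vertices
  leaves it. Such a path can only join \<open>x\<close> and \<open>y\<close>, has length 2, and its
  middle vertex is the desired \<open>z\<close>.\<close>

lemma bypass_vertex_detour:
  assumes G: "simple_connected_graph G" and v: "bypass_vertex G v"
    and xv: "(x, v) \<in> parcs G" and vy: "(v, y) \<in> parcs G"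
    and ne: "x \<noteq> y" and xy: "(x, y) \<notin> parcs G"
  obtains z where "z \<noteq> v" "(x, z) \<in> parcs G" "(z, y) \<in> parcs G"
proof -
  interpret pair_graph G using G by (simp add: simple_connected_graph_def)
  have sym: "(a, b) \<in> parcs G \<Longrightarrow> (b, a) \<in> parcs G" for a b
    by (rule arcs_symmetric)
  have verts: "x \<in> pverts G" "v \<in> pverts G" "y \<in> pverts G"
    using xv vy in_arcsD1 in_arcsD2 by blast+
  have dist: "x \<noteq> v" "v \<noteq> y" using xv vy no_loops' by blast+
  have pg: "pair_graph (path3 x v y)"
    using dist by unfold_locales (auto simp: path3_def symmetric_def sym_def)
  have sub: "subgraph (with_proj (path3 x v y)) (with_proj G)"
  proof -
    interpret K: pair_graph "path3 x v y" by (rule pg)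
    show ?thesis
      unfolding subgraph_def compatible_def
      using verts xv vy sym wf_digraph K.wf_digraph by (auto simp: path3_def)
  qed
  have "\<not> convex_subgraph (path3 x v y) G"
    using v dist ne unfolding bypass_vertex_def by auto
  then have "\<exists>p\<in>pverts (path3 x v y). \<exists>q\<in>pverts (path3 x v y). \<exists>P. shortest_path G p P q \<and>
      \<not> (set P \<subseteq> pverts (path3 x v y) \<and> set (vwalk_arcs P) \<subseteq> parcs (path3 x v y))"
    using pg sub unfolding convex_subgraph_def by blast
  then obtain p q P where pq: "p \<in> {x, v, y}" "q \<in> {x, v, y}"
    and P: "shortest_path G p P q"
    and out: "\<not> (set P \<subseteq> {x, v, y} \<and>
      set (vwalk_arcs P) \<subseteq> {(x, v), (v, x), (v, y), (y, v)})"
    unfolding path3_def pair_pre_digraph.simps by blast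
  have W: "walk_between G p P q" using P by (rule shortest_path_walk)
  note ends = W[unfolded walk_between_def]
  have P_ne: "P \<noteq> []" using W by (rule walk_between_nonempty)
  have arcs: "set (vwalk_arcs P) \<subseteq> parcs G" using ends by (auto simp: vwalk_def)
  \<comment> \<open>A shortest path from a vertex to itself has length 0, so it would stay inside
    \<open>path3 x v y\<close>.\<close>
  have not_eq: "p \<noteq> q"
  proof
    assume "p = q"
    then have "vwalk_length P \<le> vwalk_length [p]"
      using P W walk_between_ends(3)[OF W] walk_between_singleton[of p G]
      by (metis shortest_path_le_walk)
    then obtain a where "P = [a]" using P_ne by (cases P) auto
    then show False using ends pq out by auto
  qed
  \<comment> \<open>If \<open>p\<close> and \<open>q\<close> were joined by an edge of
    \<open>path3 x v y\<close>, that edge would be all of \<open>P\<close>.\<close>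
  have not_adj: "\<not> ((p, q) \<in> {(x, v), (v, x), (v, y), (y, v)})"
  proof
    assume A: "(p, q) \<in> {(x, v), (v, x), (v, y), (y, v)}"
    then have "(p, q) \<in> parcs G" using xv vy sym by auto
    then have "walk_between G p [p, q] q"
      using walk_between_ends[OF W] by (auto simp: walk_between_def vwalk_def)
    then have "vwalk_length P \<le> vwalk_length [p, q]"
      by (rule shortest_path_le_walk[OF P])
    then have "P = [p, q]"
      using P_ne not_eq ends by (cases P; cases "tl P") auto
    then show False using pq out A by auto
  qed
  have xy': "p = x \<and> q = y \<or> p = y \<and> q = x" using pq not_eq not_adj by auto
  then have pvq: "(p, v) \<in> parcs G" "(v, q) \<in> parcs G" and npq: "(p, q) \<notin> parcs G"
    using xv vy xy sym by auto
  have "walk_between G p [p, v, q] q"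
    using pvq walk_between_ends[OF W] verts by (auto simp: walk_between_def vwalk_def)
  then have "vwalk_length P \<le> vwalk_length [p, v, q]"
    by (rule shortest_path_le_walk[OF P])
  \<comment> \<open>Length 0 is excluded by \<open>not_eq\<close> and length 1 by
    \<open>npq\<close>, which leaves exactly one inner vertex.\<close>
  then obtain z where z: "P = [p, z, q]"
  proof -
    assume that: "\<And>z. P = [p, z, q] \<Longrightarrow> thesis"
    assume len: "vwalk_length P \<le> vwalk_length [p, v, q]"
    obtain R where R: "P = p # R" using ends P_ne by (cases P) auto
    obtain a R' where R': "R = a # R'" using R ends not_eq by (cases R) auto
    show thesis
    proof (cases R')
      case Nil
      then show thesis using R R' ends arcs npq by auto
    next
      case (Cons b R'')
      then show thesis using R R' ends len that by (cases R'') auto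
    qed
  qed
  have "z \<noteq> v" using out z xy' by auto
  moreover have "(p, z) \<in> parcs G" "(z, q) \<in> parcs G" using arcs z by auto
  ultimately show thesis using that xy' sym by blast
qed

lemma vwalk_middle:
  assumes "vwalk P G" "w \<in> set P" "hd P \<noteq> w" "last P \<noteq> w"
  obtains A x y B where "P = A @ [x, w, y] @ B"
proof -
  obtain A' B' where P: "P = A' @ w # B'" using assms(2) by (auto simp: in_set_conv_decomp)
  have "A' \<noteq> []" "B' \<noteq> []" using P assms(3,4) by auto
  then obtain A x y B where "A' = A @ [x]" "B' = y # B"
    by (metis neq_Nil_conv rev_exhaust)
  with P that show thesis by auto
qed

text \<open>Only a shortest path with \<open>v\<close> as an inner vertex needs repair. Its
  neighbours \<open>x\<close> and \<open>y\<close> on the path are distinct and, by minimality, not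
  adjacent, so \<open>v\<close> can be exchanged for the \<open>z\<close> of
  \<open>bypass_vertex_detour\<close> at equal length.\<close>

lemma total_mutual_visibility_set_bypass:
  assumes G: "simple_connected_graph G" and v: "bypass_vertex G v"
  shows "total_mutual_visibility_set G {v}"
  unfolding total_mutual_visibility_set_def
proof (intro conjI ballI)
  show "{v} \<subseteq> pverts G" using v by (simp add: bypass_vertex_def)
  fix b c assume bc: "b \<in> pverts G" "c \<in> pverts G"
  obtain P where P: "shortest_path G b P c" using shortest_path_exists[OF G bc] .
  have W: "walk_between G b P c" using P by (rule shortest_path_walk)
  show "visible G {v} b c"
  proof (cases "v \<in> set P \<and> v \<noteq> b \<and> v \<noteq> c")
    case False
    then show ?thesis using P unfolding visible_def by blast
  next
    case True
    interpret pair_graph G using G by (simp add: simple_connected_graph_def)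
    obtain A x y B where dec: "P = A @ [x, v, y] @ B"
      using True W by (auto simp: walk_between_def elim: vwalk_middle)
    have vw: "vwalk (A @ [x, v, y] @ B) (with_proj G)" using W dec by (simp add: walk_between_def)
    have d: "distinct P" using P by (auto simp: shortest_path_def path_between_def)
    \<comment> \<open>This is used twice: with \<open>[x, y]\<close> as a shortcut that refutes
      adjacency, and with \<open>[x, z, y]\<close> as the detour.\<close>
    have replace: "walk_between G b (A @ M @ B) c"
      if M: "vwalk M (with_proj G)" "hd M = x" "last M = y" for M
    proof -
      have "M \<noteq> []" using M by auto
      have "vwalk_arcs (A @ [x, v, y] @ B)
          = vwalk_arcs (A @ [x]) @ vwalk_arcs [x, v, y] @ vwalk_arcs (y # B)"
        using vwalk_join_arcs[of "A @ [x]" "[x,v,y] \<oplus> (y # B)"]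
          vwalk_join_arcs[of "[x,v,y]" "y # B"]
        by (simp add: vwalk_join_def)
      then have 1: "set (vwalk_arcs (A @ [x])) \<subseteq> parcs G" "set (vwalk_arcs (y # B)) \<subseteq> parcs G"
        using vw by (auto simp: vwalk_def)
      have "vwalk (A @ [x]) (with_proj G)" "vwalk (y # B) (with_proj G)"
        using vw 1 by (auto simp: vwalk_def)
      moreover have "hd (A @ [x]) = b" "last (y # B) = c"
        using W dec by (auto simp: walk_between_def hd_append)
      ultimately have "walk_between G b (A @ [x]) x" "walk_between G y (y # B) c"
        by (auto simp: walk_between_def)
      moreover have "walk_between G x M y" using M by (simp add: walk_between_def)
      ultimately have "walk_between G b ((A @ [x]) \<oplus> (M \<oplus> (y # B))) c"
        by (blast intro: walk_between_join(1))
      moreover have "(A @ [x]) \<oplus> (M \<oplus> (y # B)) = A @ M @ B"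
        using \<open>M \<noteq> []\<close> M(2) by (cases M) (auto simp: vwalk_join_def)
      ultimately show ?thesis by simp
    qed
    have arcs: "(x, v) \<in> parcs G" "(v, y) \<in> parcs G"
      using vw in_set_vwalk_arcs_append1[of _ "[x, v, y] @ B" A]
      by (auto simp: vwalk_def in_set_vwalk_arcs_append1)
    have vxy: "x \<in> pverts G" "y \<in> pverts G" using arcs in_arcsD1 in_arcsD2 by blast+
    have "(x, y) \<notin> parcs G"
    proof
      assume "(x, y) \<in> parcs G"
      then have "walk_between G b (A @ [x, y] @ B) c"
        by (intro replace) (use vxy in \<open>auto simp: vwalk_def\<close>)
      from shortest_path_le_walk[OF P this] dec show False by simp
    qed
    moreover have "x \<noteq> y" using d dec by auto
    ultimately obtain z where z: "z \<noteq> v" "(x, z) \<in> parcs G" "(z, y) \<in> parcs G"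
      using bypass_vertex_detour[OF G v arcs] by blast
    \<comment> \<open>The vertex \<open>z\<close> might a priori occur in \<open>A\<close> or
      \<open>B\<close>; this does no harm, as \<open>visibleI\<close> accepts walks.\<close>
    have "walk_between G b (A @ [x, z, y] @ B) c"
      using z in_arcsD2[OF z(2)] vxy by (intro replace) (auto simp: vwalk_def)
    then show ?thesis
    proof (rule visibleI)
      show "vwalk_length (A @ [x, z, y] @ B) \<le> vwalk_length Q" if "walk_between G b Q c" for Q
        using shortest_path_le_walk[OF P that] dec by simp
      show "set (A @ [x, z, y] @ B) \<inter> {v} \<subseteq> {b, c}" using d dec z(1) by auto
    qed
  qed
qed

section \<open>Walks in the Cartesian product\<close>

lemma pverts_cartesian_product [simp]:
  "pverts (cartesian_product G H) = pverts G \<times> pverts H"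
  by (simp add: cartesian_product_def)

lemma in_parcs_cartesian_product [simp]:
  "((g, h), (g', h')) \<in> parcs (cartesian_product G H) \<longleftrightarrow>
    g \<in> pverts G \<and> g' \<in> pverts G \<and> h \<in> pverts H \<and> h' \<in> pverts H \<and>
    ((g, g') \<in> parcs G \<and> h = h' \<or> g = g' \<and> (h, h') \<in> parcs H)"
  by (simp add: cartesian_product_def)

lemma walk_between_cons:
  assumes "x \<in> pverts G" "(x, y) \<in> parcs G" "walk_between G y P z"
  shows "walk_between G x (x # P) z" "vwalk_length (x # P) = Suc (vwalk_length P)"
  using assms walk_between_nonempty[OF assms(3)]
  by (auto simp: walk_between_def intro: vwalk_consI)

text \<open>Each arc is charged to a coordinate in which it is an arc of the factor, while the other
  coordinate stays fixed. Hence distances in the product are at least the sums of the distances in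
  the factors.\<close>

lemma walk_between_product_proj:
  assumes "walk_between (cartesian_product G H) (a, b) W (a', b')"
  shows "\<exists>P Q. walk_between G a P a' \<and> walk_between H b Q b' \<and>
    vwalk_length P + vwalk_length Q = vwalk_length W"
proof -
  have "vwalk W (with_proj (cartesian_product G H))" "hd W = (a, b)" "last W = (a', b')"
    using assms by (auto simp: walk_between_def)
  then show ?thesis
  proof (induction W arbitrary: a b rule: vwalk_induct)
    case (Base u)
    then have "walk_between G a [a] a'" "walk_between H b [b] b'"
      by (auto intro: walk_between_singleton)
    then show ?case by fastforce
  next
    case (Cons u v es)
    obtain c d where v: "v = (c, d)" by (cases v)
    have u: "u = (a, b)" using Cons.prems by simp
    obtain P Q where PQ: "walk_between G c P a'" "walk_between H d Q b'"
      and len: "vwalk_length P + vwalk_length Q = vwalk_length (v # es)"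
      using Cons.IH[of c d] Cons.prems v by auto
    have Suc: "vwalk_length (u # v # es) = Suc (vwalk_length (v # es))" by simp
    have "a \<in> pverts G \<and> b \<in> pverts H \<and>
      ((a, c) \<in> parcs G \<and> b = d \<or> a = c \<and> (b, d) \<in> parcs H)"
      using Cons.hyps(1) by (simp add: u v)
    then consider "a \<in> pverts G" "(a, c) \<in> parcs G" "b = d"
      | "b \<in> pverts H" "a = c" "(b, d) \<in> parcs H" by blast
    then show ?case
    proof cases
      case 1
      then show ?thesis
        using walk_between_cons[OF 1(1,2) PQ(1)] PQ(2) len Suc by (metis add_Suc)
    next
      case 2
      then show ?thesis
        using walk_between_cons[OF 2(1,3) PQ(2)] PQ(1) len Suc by (metis add_Suc_right)
    qed
  qed
qed

lemma vwalk_arcs_map: "vwalk_arcs (map f P) = map (map_prod f f) (vwalk_arcs P)"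
  by (induct P rule: vwalk_arcs.induct) auto

lemma walk_between_map:
  assumes "walk_between G x P y"
    and "\<And>u. u \<in> pverts G \<Longrightarrow> f u \<in> pverts K"
    and "\<And>u v. (u, v) \<in> parcs G \<Longrightarrow> u \<in> pverts G \<Longrightarrow> v \<in> pverts G \<Longrightarrow> (f u, f v) \<in> parcs K"
  shows "walk_between K (f x) (map f P) (f y)"
proof -
  have "P \<noteq> []" using assms(1) by (rule walk_between_nonempty)
  then show ?thesis
    using assms arcs_in_vwalk_arcs[of _ P]
    by (fastforce simp: walk_between_def vwalk_def vwalk_arcs_map hd_map last_map)
qed

lemma walk_between_product_left:
  assumes "walk_between G a P a'" "b \<in> pverts H"
  shows "walk_between (cartesian_product G H) (a, b) (map (\<lambda>u. (u, b)) P) (a', b)"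
  by (rule walk_between_map[OF assms(1)]) (auto simp: assms(2))

lemma walk_between_product_right:
  assumes "walk_between H b Q b'" "a \<in> pverts G"
  shows "walk_between (cartesian_product G H) (a, b) (map (Pair a) Q) (a, b')"
  by (rule walk_between_map[OF assms(1)]) (auto simp: assms(2))

text \<open>By projection, no walk between these ends is shorter than the two factor distances
  together, so \<open>W\<close> has minimal length.\<close>

lemma visible_productI:
  assumes "shortest_path G a P a'" "shortest_path H b Q b'"
    and "walk_between (cartesian_product G H) (a, b) W (a', b')"
    and "vwalk_length W = vwalk_length P + vwalk_length Q"
    and "set W \<inter> X \<subseteq> {(a, b), (a', b')}"
  shows "visible (cartesian_product G H) X (a, b) (a', b')"
  using assms(3)
proof (rule visibleI)
  fix R assume "walk_between (cartesian_product G H) (a, b) R (a', b')"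
  then show "vwalk_length W \<le> vwalk_length R"
    using walk_between_product_proj[of G H a b R a' b'] assms(4)
      shortest_path_le_walk[OF assms(1)] shortest_path_le_walk[OF assms(2)]
    by (metis add_mono)
qed (rule assms(5))

section \<open>Visibility of pairs in the product\<close>

text \<open>If \<open>x\<close> is outside \<open>U\<close>, take \<open>p = x\<close> and a trivial
  first piece. Otherwise the second vertex of the walk is outside \<open>U\<close> by
  independence.\<close>

lemma walk_split_first:
  assumes "independent_set G U" "walk_between G x P y" "x \<noteq> y"
  obtains p P1 P2 where "walk_between G x P1 p" "walk_between G p P2 y" "p \<notin> U"
    "set P1 \<subseteq> {x, p}" "vwalk_length P1 + vwalk_length P2 = vwalk_length P"
proof (cases "x \<in> U")
  case False
  show thesis
    by (rule that[of "[x]" x P])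
      (use assms False walk_between_ends[OF assms(2)] in \<open>auto intro: walk_between_singleton\<close>)
next
  case True
  obtain p R where P: "P = x # p # R"
    using assms(2,3) walk_between_nonempty[OF assms(2)]
    by (cases P; cases "tl P") (auto simp: walk_between_def)
  have "(x, p) \<in> parcs G" using assms(2) P by (auto simp: walk_between_def vwalk_def)
  show thesis
    by (rule that[of "[x, p]" p "p # R"])
      (use assms True P \<open>(x, p) \<in> parcs G\<close> in
        \<open>auto simp: walk_between_def vwalk_def independent_set_def\<close>)
qed

lemma walk_split_last:
  assumes "independent_set G U" "walk_between G x P y" "x \<noteq> y"
  obtains p P1 P2 where "walk_between G x P1 p" "walk_between G p P2 y" "p \<notin> U"
    "set P2 \<subseteq> {p, y}" "vwalk_length P1 + vwalk_length P2 = vwalk_length P"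
proof (cases "y \<in> U")
  case False
  show thesis
    by (rule that[of P y "[y]"])
      (use assms False walk_between_ends[OF assms(2)] in \<open>auto intro: walk_between_singleton\<close>)
next
  case True
  obtain R' where "P = R' @ [y]"
    using assms(2) walk_between_nonempty[OF assms(2)]
    by (metis append_butlast_last_id walk_between_def)
  moreover from this have "R' \<noteq> []" using assms(2,3) by (auto simp: walk_between_def)
  ultimately obtain R p where P: "P = (R @ [p]) @ [y]" by (metis rev_exhaust)
  have arcs: "vwalk_arcs P = vwalk_arcs (R @ [p]) @ [(p, y)]"
    unfolding P by (subst vwalk_arcs_append) auto
  then have "(p, y) \<in> parcs G" using assms(2) by (auto simp: walk_between_def vwalk_def)
  moreover have "hd (R @ [p]) = x" using assms(2) P by (auto simp: walk_between_def hd_append)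
  ultimately show thesis
    by (intro that[of "R @ [p]" p "[p, y]"])
      (use assms True P arcs in \<open>auto simp: walk_between_def vwalk_def independent_set_def\<close>)
qed

text \<open>
  When both coordinates differ, shortest paths from \<open>a\<close> to \<open>a'\<close> and from \<open>b\<close> to \<open>b'\<close> contain
  vertices \<open>p \<notin> U\<close>, at distance at most 1 from \<open>a\<close>, and \<open>q \<notin> V\<close>, at distance at most 1
  from \<open>b'\<close>, as \<open>U\<close> and \<open>V\<close> are independent. The route
  \<open>(a, b), (p, b), (p, q), (a', q), (a', b')\<close> has all its inner vertices in the layers
  of \<open>p\<close> and \<open>q\<close>, which miss \<open>U \<times> V\<close>.
\<close>

lemma total_mutual_visibility_set_product:
  assumes G: "simple_connected_graph G" and H: "simple_connected_graph H"
    and U: "independent_set G U" and V: "independent_set H V" and X: "X \<subseteq> U \<times> V"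
    and fibG: "\<And>b. b \<in> pverts H \<Longrightarrow> total_mutual_visibility_set G {a. (a, b) \<in> X}"
    and fibH: "\<And>a. a \<in> pverts G \<Longrightarrow> total_mutual_visibility_set H {b. (a, b) \<in> X}"
  shows "total_mutual_visibility_set (cartesian_product G H) X"
  unfolding total_mutual_visibility_set_def
proof (intro conjI ballI)
  show "X \<subseteq> pverts (cartesian_product G H)"
    using U V X by (auto simp: independent_set_def)
  fix s t assume "s \<in> pverts (cartesian_product G H)" "t \<in> pverts (cartesian_product G H)"
  then obtain a b a' b' where st: "s = (a, b)" "t = (a', b')"
    and vs: "a \<in> pverts G" "a' \<in> pverts G" "b \<in> pverts H" "b' \<in> pverts H" by auto
  obtain P where P: "shortest_path G a P a'" using shortest_path_exists[OF G vs(1,2)] .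
  obtain Q where Q: "shortest_path H b Q b'" using shortest_path_exists[OF H vs(3,4)] .
  note PQ = P[THEN shortest_path_walk] Q[THEN shortest_path_walk]
  consider "a = a'" | "b = b'" | "a \<noteq> a'" "b \<noteq> b'" by blast
  then have "visible (cartesian_product G H) X (a, b) (a', b')"
  proof cases
    case 1
    have "visible H {b. (a, b) \<in> X} b b'"
      using fibH[OF vs(1)] vs by (auto simp: total_mutual_visibility_set_def)
    then obtain R where R: "shortest_path H b R b'" "set R \<inter> {b. (a, b) \<in> X} \<subseteq> {b, b'}"
      unfolding visible_def by blast
    \<comment> \<open>So \<open>P\<close> has length 0, and the copy of \<open>R\<close> in the
      layer of \<open>a\<close> has the length that \<open>visible_productI\<close> demands.\<close>
    have "vwalk_length P \<le> vwalk_length [a]"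
      using P 1 walk_between_singleton[OF vs(1)] by (blast intro: shortest_path_le_walk)
    then show ?thesis
      using walk_between_product_right[OF shortest_path_walk[OF R(1)] vs(1)] R(2) 1
      by (intro visible_productI[OF P R(1), of "map (Pair a) R"]) auto
  next
    case 2
    have "visible G {a. (a, b) \<in> X} a a'"
      using fibG[OF vs(3)] vs by (auto simp: total_mutual_visibility_set_def)
    then obtain R where R: "shortest_path G a R a'" "set R \<inter> {a. (a, b) \<in> X} \<subseteq> {a, a'}"
      unfolding visible_def by blast
    have "vwalk_length Q \<le> vwalk_length [b]"
      using Q 2 walk_between_singleton[OF vs(3)] by (blast intro: shortest_path_le_walk)
    then show ?thesis
      using walk_between_product_left[OF shortest_path_walk[OF R(1)] vs(3)] R(2) 2
      by (intro visible_productI[OF R(1) Q, of "map (\<lambda>u. (u, b)) R"]) auto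
  next
    case 3
    \<comment> \<open>The outer legs \<open>W1\<close> and \<open>W4\<close> run in the layers of
      \<open>b\<close> and \<open>a'\<close>, which may meet \<open>X\<close>. Splitting near the
      start in \<open>G\<close> and near the end in \<open>H\<close> confines these legs to their
      own end vertices.\<close>
    obtain p P1 P2 where p: "walk_between G a P1 p" "walk_between G p P2 a'" "p \<notin> U"
      "set P1 \<subseteq> {a, p}" "vwalk_length P1 + vwalk_length P2 = vwalk_length P"
      using walk_split_first[OF U PQ(1) 3(1)] .
    obtain q Q1 Q2 where q: "walk_between H b Q1 q" "walk_between H q Q2 b'" "q \<notin> V"
      "set Q2 \<subseteq> {q, b'}" "vwalk_length Q1 + vwalk_length Q2 = vwalk_length Q"
      using walk_split_last[OF V PQ(2) 3(2)] .
    note pv = walk_between_ends(4)[OF p(1)] and qv = walk_between_ends(4)[OF q(1)]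
    define W1 where "W1 = map (\<lambda>u. (u, b)) P1"
    define W2 where "W2 = map (Pair p) Q1"
    define W3 where "W3 = map (\<lambda>u. (u, q)) P2"
    define W4 where "W4 = map (Pair a') Q2"
    let ?K = "cartesian_product G H"
    have W: "walk_between ?K (a, b) W1 (p, b)" "walk_between ?K (p, b) W2 (p, q)"
      "walk_between ?K (p, q) W3 (a', q)" "walk_between ?K (a', q) W4 (a', b')"
      unfolding W1_def W2_def W3_def W4_def
      using p(1,2) q(1,2) pv qv vs
      by (auto intro: walk_between_product_left walk_between_product_right)
    note J3 = walk_between_join[OF W(3,4)]
    note J2 = walk_between_join[OF W(2) J3(1)]
    note J1 = walk_between_join[OF W(1) J2(1)]
    have sets: "set W1 \<subseteq> {(a, b), (p, b)}" "set W2 \<subseteq> {p} \<times> UNIV" "set W3 \<subseteq> UNIV \<times> {q}"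
      "set W4 \<subseteq> {(a', q), (a', b')}"
      using p(4) q(4) by (auto simp: W1_def W2_def W3_def W4_def)
    have "vwalk_length W1 = vwalk_length P1" "vwalk_length W2 = vwalk_length Q1"
      "vwalk_length W3 = vwalk_length P2" "vwalk_length W4 = vwalk_length Q2"
      by (auto simp: W1_def W2_def W3_def W4_def)
    then have len: "vwalk_length (W1 \<oplus> W2 \<oplus> W3 \<oplus> W4) = vwalk_length P + vwalk_length Q"
      using J1(2) J2(2) J3(2) p(5) q(5) by linarith
    have "set (W1 \<oplus> W2 \<oplus> W3 \<oplus> W4) \<subseteq> set W1 \<union> set W2 \<union> set W3 \<union> set W4"
      using J1(3) J2(3) J3(3) by blast
    then have "set (W1 \<oplus> W2 \<oplus> W3 \<oplus> W4) \<subseteq>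
        {(a, b), (p, b), (a', q), (a', b')} \<union> {p} \<times> UNIV \<union> UNIV \<times> {q}"
      using sets by blast
    then have "set (W1 \<oplus> W2 \<oplus> W3 \<oplus> W4) \<inter> X \<subseteq> {(a, b), (a', b')}"
      using X p(3) q(3) by blast
    then show ?thesis
      using visible_productI[OF P Q J1(1) len] by blast
  qed
  then show "visible (cartesian_product G H) X s t" using st by simp
qed

section \<open>The maximum and the final count\<close>

lemma card_le_mu_t:
  assumes "finite (pverts G)" "total_mutual_visibility_set G X"
  shows "card X \<le> mu_t G"
proof -
  have "{X. total_mutual_visibility_set G X} \<subseteq> Pow (pverts G)"
    by (auto simp: total_mutual_visibility_set_def)
  then have "finite {X. total_mutual_visibility_set G X}"
    using assms(1) by (rule finite_subset[OF _ finite_Pow_iff[THEN iffD2]])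
  then show ?thesis
    unfolding mu_t_def using assms(2) by (intro Max_ge) auto
qed

theorem theorem5p2:
  fixes G :: "'a pair_pre_digraph" and H :: "'b pair_pre_digraph"
  assumes "simple_connected_graph G" and "simple_connected_graph H"
    and "bypass_over_visible G" and "bypass_over_visible H"
  shows "mu_t (cartesian_product G H) > mu_t G * mu_t H"
proof -
  interpret G: pair_graph G using assms(1) by (simp add: simple_connected_graph_def)
  interpret H: pair_graph H using assms(2) by (simp add: simple_connected_graph_def)
  obtain U S where U: "independent_set G U" "\<forall>u\<in>U. bypass_vertex G u" "mu_t_set G S" "S \<subset> U"
    using assms(3) unfolding bypass_over_visible_def by blast
  obtain V T where V: "independent_set H V" "\<forall>u\<in>V. bypass_vertex H u" "mu_t_set H T" "T \<subset> V"
    using assms(4) unfolding bypass_over_visible_def by blast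
  obtain g where g: "g \<in> U" "g \<notin> S" using U(4) by blast
  obtain h where h: "h \<in> V" "h \<notin> T" using V(4) by blast
  let ?X = "insert (g, h) (S \<times> T)"
  have S: "total_mutual_visibility_set G S" "card S = mu_t G"
    and T: "total_mutual_visibility_set H T" "card T = mu_t H"
    using U(3) V(3) by (auto simp: mu_t_set_def)
  have gh: "total_mutual_visibility_set G {g}" "total_mutual_visibility_set H {h}"
    using total_mutual_visibility_set_bypass[OF assms(1)] U(2) g(1)
      total_mutual_visibility_set_bypass[OF assms(2)] V(2) h(1) by auto
  have "total_mutual_visibility_set (cartesian_product G H) ?X"
  proof (rule total_mutual_visibility_set_product[OF assms(1,2) U(1) V(1)])
    show "?X \<subseteq> U \<times> V" using U(4) V(4) g h by auto
    fix b
    \<comment> \<open>Since \<open>h\<close> is not in \<open>T\<close>, the layer of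
      \<open>h\<close> meets \<open>?X\<close> in \<open>g\<close> alone. Any other layer gives
      \<open>S\<close> or the empty set, hence an inclusion and the appeal to subsets.\<close>
    have "{a. (a, b) \<in> ?X} \<subseteq> (if b = h then {g} else S)" using h by auto
    then show "total_mutual_visibility_set G {a. (a, b) \<in> ?X}"
      using S(1) gh(1) by (auto split: if_splits intro: total_mutual_visibility_set_subset)
  next
    fix a
    have "{b. (a, b) \<in> ?X} \<subseteq> (if a = g then {h} else T)" using g by auto
    then show "total_mutual_visibility_set H {b. (a, b) \<in> ?X}"
      using T(1) gh(2) by (auto split: if_splits intro: total_mutual_visibility_set_subset)
  qed
  then have "card ?X \<le> mu_t (cartesian_product G H)"
    by (rule card_le_mu_t[rotated]) simp
  moreover have "finite S" "finite T"
    using S(1) T(1) by (auto simp: total_mutual_visibility_set_def intro: finite_subset)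
  \<comment> \<open>As \<open>g\<close> is not in \<open>S\<close>, the pair \<open>(g, h)\<close>
    is a new element; it yields the strict inequality.\<close>
  then have "card ?X = Suc (mu_t G * mu_t H)"
    using g S(2) T(2) by (simp add: card_cartesian_product)
  ultimately show ?thesis by simp
qed

end
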